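(* Let $a,b,c$ be integers with $2\le a<b<c$, $c\ne a+b$ and $\gcd(a,b,c)=1$. Put $S=\{a,b,c\}$, $B=\{a,b\}$, $\rho=c\bmod(a+b)$. Let $P\in\{a+b,\,c+a,\,c+b\}$ be such that $\rho\in\Theta_P$. Then $$\mathcal W_0(S)=\begin{cases}\mathcal W_0(B),&P=a+b,\\ T_P,&P\in\{c+a,\,c+b\}.\end{cases}$$ In particular, $\mathcal W_0(S)$ is $P$-periodic from $0$, i.e. $x\in\mathcal W_0(S)\iff x+P\in\mathcal W_0(S)$ for all $x\in\mathbb N$.
   Context: $\mathbb N=\{0,1,2,\dots\}$. For a finite nonempty set $S$ of positive integers, the subtraction game $S$ has positions $x\in\mathbb N$ and legal moves $x\mapsto x-s$ for $s\in S$, $s\le x$; a player unable to move loses. The nim-value is $\mathcal G_S(x)=\operatorname{mex}\{\mathcal G_S(x-s):s\in S,\ s\le x\}$, where mex is the least non-negative integer not in the set, and $\mathcal W_0(S)=\{x\in\mathbb N:\mathcal G_S(x)=0\}$ is the set of $\mathrm P$-positions. Integer intervals: $[u,v]=\{u,\dots,v\}$, $[u,v)=\{u,\dots,v-1\}$ (empty if there are no such integers). Given $a<b$, write $B=\{a,b\}$, $\delta=b-a=\eta a+\varepsilon$ with $\eta=\lfloor\delta/a\rfloor$, $0\le\varepsilon<a$, and put $\mathcal Z=\mathcal W_0(B)\cap[0,a+b)$, $D=[a,b)\setminus\mathcal Z$, and $$\Lambda=\begin{cases}[(\eta+1)a,\ (\eta+1)a+\varepsilon),&\eta\text{ even},\\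 [\eta a+\varepsilon,\ (\eta+1)a),&\eta\text{ odd}.\end{cases}$$ These sets are viewed as subsets of $\mathbb Z/(a+b)\mathbb Z$, and residues are identified with $[0,a+b)$. The admissible sets $\Theta_{a+b},\Theta_{c+a},\Theta_{c+b}\subseteq\mathbb Z/(a+b)\mathbb Z$ (they depend only on $a,b$; the subscripts label the candidate periods) are defined, with translates read modulo $a+b$, by: $\rho\in\Theta_{a+b}\iff\mathcal Z\cap(\mathcal Z+\rho)=\varnothing$; $\rho\in\Theta_{c+a}\iff\mathcal Z\cap[0,\delta)\cap(\mathcal Z+(\delta-\rho))=\varnothing$; $\rho\in\Theta_{c+b}\iff(\rho+\Lambda)\cap\mathcal Z=\varnothing$ and $(\rho+D)\cap\Lambda=\varnothing$. For $P\ge c$, $T_P=\{x\in\mathbb N:(x\bmod P)\in\mathcal W_0(B)\text{ and }(x\bmod P)-c\notin\mathcal W_0(B)\}$, with the convention $y\notin\mathcal W_0(B)$ for $y<0$. *)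

theory Defs
  imports Main
begin

definition mex :: "nat set \<Rightarrow> nat" where
  "mex A = (LEAST n. n \<notin> A)"

text \<open>Subtraction sets consist of positive integers; the guard \<open>0 < s\<close> only serves to make the
  recursion well-founded for arbitrary \<open>S\<close>.\<close>

function nim_value :: "nat set \<Rightarrow> nat \<Rightarrow> nat" where
  "nim_value S x = mex ((\<lambda>s. nim_value S (x - s)) ` {s \<in> S. 0 < s \<and> s \<le> x})"
  by auto
termination by (relation "measure snd") auto

declare nim_value.simps [simp del]

definition P_positions :: "nat set \<Rightarrow> nat set" where
  "P_positions S = {x. nim_value S x = 0}"

text \<open>Throughout, \<open>a < b\<close>, and subsets of \<open>\<int>/(a+b)\<int>\<close> are represented by the sets of their
  canonical representatives in \<open>{0..<a+b}\<close>.\<close>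

definition translate_mod :: "nat \<Rightarrow> nat set \<Rightarrow> int \<Rightarrow> nat set" where
  "translate_mod m X t = (\<lambda>x. nat ((int x + t) mod int m)) ` X"

definition Zset :: "nat \<Rightarrow> nat \<Rightarrow> nat set" where
  "Zset a b = P_positions {a, b} \<inter> {0..<a + b}"

definition Dset :: "nat \<Rightarrow> nat \<Rightarrow> nat set" where
  "Dset a b = {a..<b} - Zset a b"

definition Lam :: "nat \<Rightarrow> nat \<Rightarrow> nat set" where
  "Lam a b =
    (let \<delta> = b - a; \<eta> = \<delta> div a; \<epsilon> = \<delta> mod a
     in if even \<eta> then {(\<eta> + 1) * a..<(\<eta> + 1) * a + \<epsilon>}
        else {\<eta> * a + \<epsilon>..<(\<eta> + 1) * a})"

definition Theta_ab :: "nat \<Rightarrow> nat \<Rightarrow> nat set" where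
  "Theta_ab a b =
    {\<rho> \<in> {0..<a + b}. Zset a b \<inter> translate_mod (a + b) (Zset a b) (int \<rho>) = {}}"

definition Theta_ca :: "nat \<Rightarrow> nat \<Rightarrow> nat set" where
  "Theta_ca a b =
    {\<rho> \<in> {0..<a + b}. Zset a b \<inter> {0..<b - a} \<inter>
       translate_mod (a + b) (Zset a b) (int (b - a) - int \<rho>) = {}}"

definition Theta_cb :: "nat \<Rightarrow> nat \<Rightarrow> nat set" where
  "Theta_cb a b =
    {\<rho> \<in> {0..<a + b}.
       translate_mod (a + b) (Lam a b) (int \<rho>) \<inter> Zset a b = {} \<and>
       translate_mod (a + b) (Dset a b) (int \<rho>) \<inter> Lam a b = {}}"

text \<open>The explicit guard \<open>c \<le> x mod P\<close> replaces membership of a possibly negative difference,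
  since subtraction on \<^typ>\<open>nat\<close> truncates.\<close>

definition Tset :: "nat \<Rightarrow> nat \<Rightarrow> nat \<Rightarrow> nat \<Rightarrow> nat set" where
  "Tset a b c P =
    {x. x mod P \<in> P_positions {a, b} \<and>
        \<not> (c \<le> x mod P \<and> x mod P - c \<in> P_positions {a, b})}"

end

theory Submission
  imports Defs
begin

text \<open>The P-positions of a subtraction game form its unique kernel: \<open>K\<close> is the set of P-positions
  as soon as no move leads from \<open>K\<close> to \<open>K\<close> and every position outside \<open>K\<close> has a move into \<open>K\<close>.
  Since the candidate sets are periodic, this is checked on residues, where a move that leaves the
  fundamental interval wraps around. With respect to the kernel of \<open>{a, b}\<close>, the move by \<open>c\<close> (for
  \<open>P = a + b\<close>), the wrapped move by \<open>b\<close> (for \<open>P = c + a\<close>) and the wrapped move by \<open>a\<close> (for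
  \<open>P = c + b\<close>) are the only ones that can lead from \<open>K\<close> to \<open>K\<close>, and the admissible sets exclude
  exactly these. For \<open>P = c + b\<close> the residues \<open>c + d\<close> with \<open>d \<in> D\<close> additionally need a move into
  \<open>K\<close>, which is the second condition on \<open>\<Theta>\<close>.\<close>

section \<open>Mex, P-positions and uniqueness of the kernel\<close>

lemma mex_eq_0_iff:
  assumes "finite A"
  shows "mex A = 0 \<longleftrightarrow> 0 \<notin> A"
proof -
  \<comment> \<open>Finiteness supplies a witness for the \<open>LEAST\<close> in
    \<open>mex\<close>.\<close>
  obtain n where "n \<notin> A" using ex_new_if_finite[OF infinite_UNIV_nat assms] by blast
  then have "mex A \<notin> A" unfolding mex_def by (rule LeastI)
  moreover have "mex A \<le> 0" if "0 \<notin> A" unfolding mex_def using that by (rule Least_le)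
  ultimately show ?thesis by auto
qed

lemma P_positions_iff:
  "x \<in> P_positions S \<longleftrightarrow> (\<forall>s\<in>S. 0 < s \<longrightarrow> s \<le> x \<longrightarrow> x - s \<notin> P_positions S)"
proof -
  \<comment> \<open>\<open>S\<close> may be infinite, but only its elements up to \<open>x\<close>
    give moves.\<close>
  have "finite {s \<in> S. 0 < s \<and> s \<le> x}" by (rule finite_subset[of _ "{..x}"]) auto
  then show ?thesis
    unfolding P_positions_def
    by (subst mem_Collect_eq, subst nim_value.simps, subst mex_eq_0_iff) (auto simp: image_iff)
qed

text \<open>Moves strictly decrease the position, so by strong induction the kernel equation has at
  most one solution.\<close>

lemma P_positions_eqI:
  assumes "\<And>x. x \<in> K \<longleftrightarrow> (\<forall>s\<in>S. 0 < s \<longrightarrow> s \<le> x \<longrightarrow> x - s \<notin> K)"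
  shows "P_positions S = K"
proof -
  have "x \<in> P_positions S \<longleftrightarrow> x \<in> K" for x
  proof (induction x rule: less_induct)
    case (less x)
    have "x - s \<in> P_positions S \<longleftrightarrow> x - s \<in> K" if "0 < s" "s \<le> x" for s
      using less that by simp
    then show ?case using P_positions_iff[of x S] assms[of x] by blast
  qed
  then show ?thesis by blast
qed

section \<open>Periodic kernels\<close>

lemma mod_diff_nat:
  fixes x s m :: nat
  assumes "s \<le> m" "s \<le> x" "0 < m"
  shows "(x - s) mod m = (if s \<le> x mod m then x mod m - s else x mod m + m - s)"
proof (cases "s \<le> x mod m")
  case True
  have "x - s = m * (x div m) + (x mod m - s)"
    using True mult_div_mod_eq[of m x] by linarith
  moreover have "x mod m - s < m" using mod_less_divisor[OF assms(3), of x] by linarith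
  ultimately have "(x - s) mod m = x mod m - s" by (metis mod_mult_self4 mod_less)
  then show ?thesis using True by simp
next
  case False
  \<comment> \<open>With quotient 0, \<open>x\<close> would be its own residue, contradicting
    \<open>s \<le> x\<close>; so one period can be borrowed.\<close>
  then have "x div m \<noteq> 0" using assms(2) mult_div_mod_eq[of m x] by (metis add_0 mult_0_right)
  then obtain q where q: "x div m = Suc q" by (cases "x div m") auto
  have "x - s = m * q + (x mod m + m - s)"
    using False assms mult_div_mod_eq[of m x] unfolding q by simp
  moreover have "x mod m + m - s < m" using False assms by linarith
  ultimately have "(x - s) mod m = x mod m + m - s" by (metis mod_mult_self4 mod_less)
  then show ?thesis using False by simp
qed

text \<open>Since \<open>s \<le> m\<close>, a move wraps around at most once, so one period
  suffices. Absorption must use an unwrapped move, because wrapped moves are illegal in the first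
  period.\<close>

lemma P_positions_periodicI:
  assumes S: "\<And>s. s \<in> S \<Longrightarrow> 0 < s \<and> s \<le> m" and m: "0 < m"
    and inner: "\<And>r s. r < m \<Longrightarrow> r \<in> K \<Longrightarrow> s \<in> S \<Longrightarrow> s \<le> r \<Longrightarrow> r - s \<notin> K"
    and wrap: "\<And>r s. r < m \<Longrightarrow> r \<in> K \<Longrightarrow> s \<in> S \<Longrightarrow> r < s \<Longrightarrow> r + m - s \<notin> K"
    and absorb: "\<And>r. r < m \<Longrightarrow> r \<notin> K \<Longrightarrow> \<exists>s\<in>S. s \<le> r \<and> r - s \<in> K"
  shows "P_positions S = {x. x mod m \<in> K}"
proof (rule P_positions_eqI, unfold mem_Collect_eq)
  fix x
  have lt: "x mod m < m" using m by simp
  show "x mod m \<in> K \<longleftrightarrow> (\<forall>s\<in>S. 0 < s \<longrightarrow> s \<le> x \<longrightarrow> (x - s) mod m \<notin> K)"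
  proof (cases "x mod m \<in> K")
    case True
    have "(x - s) mod m \<notin> K" if "s \<in> S" "s \<le> x" for s
      using inner[OF lt True \<open>s \<in> S\<close>] wrap[OF lt True \<open>s \<in> S\<close>] S[OF \<open>s \<in> S\<close>] that m
      by (simp add: mod_diff_nat)
    then show ?thesis using True by blast
  next
    case False
    then obtain s where s: "s \<in> S" "s \<le> x mod m" "x mod m - s \<in> K" using absorb[OF lt] by blast
    then have "s \<le> x" using mod_less_eq_dividend[of x m] by linarith
    then have "(x - s) mod m \<in> K" using s S[of s] m by (simp add: mod_diff_nat)
    then show ?thesis using False s(1) S[of s] \<open>s \<le> x\<close> by blast
  qed
qed

section \<open>The game with two moves\<close>

text \<open>Cut [0, b) into blocks of length \<open>a\<close>, the last possibly shorter.
  Subtracting \<open>a\<close>, or adding it by a wrapped move \<open>b\<close>, changes the parity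
  of the block; a wrapped move \<open>a\<close> lands in [b, a + b), outside the kernel.\<close>

lemma P_positions_two:
  fixes a b :: nat
  assumes "0 < a" "a < b"
  shows "P_positions {a, b} = {x. x mod (a + b) \<in> {r. r < b \<and> even (r div a)}}"
proof (rule P_positions_periodicI)
  have step: "(r + a) div a = Suc (r div a)" for r
    using assms by (simp add: div_add_self2)
  have pred: "r div a = Suc ((r - a) div a)" if "a \<le> r" for r
    using step[of "r - a"] that by simp
  let ?K = "{r. r < b \<and> even (r div a)}"
  show "r - s \<notin> ?K" if "r < a + b" "r \<in> ?K" "s \<in> {a, b}" "s \<le> r" for r s
    using that pred[of r] by auto
  show "r + (a + b) - s \<notin> ?K" if "r < a + b" "r \<in> ?K" "s \<in> {a, b}" "r < s" for r s
  proof -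
    have "s = a \<Longrightarrow> r + (a + b) - s = r + b" "s = b \<Longrightarrow> r + (a + b) - s = r + a" by simp_all
    then show ?thesis using that(2,3) step[of r] by (elim insertE emptyE) simp_all
  qed
  show "\<exists>s\<in>{a, b}. s \<le> r \<and> r - s \<in> ?K" if "r < a + b" "r \<notin> ?K" for r
  proof (cases "r < b")
    case True
    then have "odd (r div a)" using that by simp
    then have "a \<le> r" by (metis div_less even_zero not_le)
    then show ?thesis using pred[of r] \<open>odd (r div a)\<close> True by auto
  next
    case False
    \<comment> \<open>From [b, a + b) the move \<open>b\<close> reaches the first block, whose index
      0 is even.\<close>
    then have "r - b < a" using that by linarith
    then have "r - b \<in> ?K" using assms by simp
    then show ?thesis using False by auto
  qed
qed (use assms in auto)

lemma P_positions_two_mod: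
  assumes "0 < a" "a < b"
  shows "x mod (a + b) \<in> P_positions {a, b} \<longleftrightarrow> x \<in> P_positions {a, b}"
  unfolding P_positions_two[OF assms] by simp

lemma P_positions_two_less:
  assumes "0 < a" "a < b" "x < a + b"
  shows "x \<in> P_positions {a, b} \<longleftrightarrow> x < b \<and> even (x div a)"
  unfolding P_positions_two[OF assms(1,2)] using assms(3) by simp

lemma mod_in_Zset_iff:
  assumes "0 < a" "a < b"
  shows "x mod (a + b) \<in> Zset a b \<longleftrightarrow> x \<in> P_positions {a, b}"
  unfolding Zset_def using P_positions_two_mod[OF assms, of x] assms by simp

text \<open>The window [b - a, b) has length \<open>a\<close> and meets only the blocks with indices
  \<eta> and \<eta> + 1, separated at (\<eta> + 1) * a. \<open>Lam\<close> is its part in the one of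
  odd index.\<close>

lemma Lam_eq:
  assumes "0 < a" "a < b"
  shows "Lam a b = {b - a..<b} - P_positions {a, b}"
proof -
  define \<eta> where "\<eta> = (b - a) div a"
  define \<epsilon> where "\<epsilon> = (b - a) mod a"
  have ba: "b - a = \<eta> * a + \<epsilon>" and eps: "\<epsilon> < a"
    using assms unfolding \<eta>_def \<epsilon>_def by simp_all
  then have b: "b = (\<eta> + 1) * a + \<epsilon>" using assms by (simp add: algebra_simps)
  have "x div a = (if x < (\<eta> + 1) * a then \<eta> else \<eta> + 1)" if "b - a \<le> x" "x < b" for x
  proof (cases "x < (\<eta> + 1) * a")
    case True
    have "\<eta> * a \<le> x" using that ba by linarith
    then show ?thesis using True by (simp add: div_nat_eqI mult.commute)
  next
    case False
    then show ?thesis using that b eps by (simp add: div_nat_eqI algebra_simps)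
  qed
  then have in_P: "x \<in> P_positions {a, b} \<longleftrightarrow> even (if x < (\<eta> + 1) * a then \<eta> else \<eta> + 1)"
    if "b - a \<le> x" "x < b" for x
    using P_positions_two_less[OF assms, of x] that by simp
  have Lam: "Lam a b = (if even \<eta> then {(\<eta> + 1) * a..<b} else {b - a..<(\<eta> + 1) * a})"
    unfolding Lam_def Let_def \<eta>_def[symmetric] \<epsilon>_def[symmetric] ba[symmetric] b[symmetric] by simp
  have "b - a \<le> (\<eta> + 1) * a" "(\<eta> + 1) * a \<le> b" using ba eps b by simp_all
  then have "x \<in> Lam a b \<longleftrightarrow> b - a \<le> x \<and> x < b \<and> x \<notin> P_positions {a, b}" for x
    unfolding Lam using in_P[of x] by (auto split: if_splits)
  then show ?thesis by (intro set_eqI) simp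
qed

text \<open>An integer congruence permits negative shifts and any representative
  \<open>y\<close>.\<close>

lemma in_translate_modI:
  assumes "x \<in> X" "(int x + t) mod int m = int y mod int m"
  shows "y mod m \<in> translate_mod m X t"
proof -
  have "nat ((int x + t) mod int m) = y mod m" unfolding assms(2) of_nat_mod[symmetric] by simp
  then show ?thesis using assms(1) unfolding translate_mod_def by force
qed

section \<open>The game with three moves, one candidate period at a time\<close>

lemma P_positions_three_ab:
  fixes a b c :: nat
  assumes ab: "0 < a" "a < b" and \<Theta>: "c mod (a + b) \<in> Theta_ab a b"
  shows "P_positions {a, b, c} = P_positions {a, b}"
proof (rule P_positions_eqI)
  let ?W = "P_positions {a, b}"
  \<comment> \<open>A \<open>c\<close>-move inside \<open>?W\<close> would put the residue of
    \<open>x\<close> into both \<open>Zset a b\<close> and its translate by \<rho>.\<close>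
  have "x - c \<notin> ?W" if "x \<in> ?W" "c \<le> x" for x
  proof
    assume "x - c \<in> ?W"
    then have "(x - c) mod (a + b) \<in> Zset a b" using mod_in_Zset_iff[OF ab] by blast
    then have "x mod (a + b) \<in> translate_mod (a + b) (Zset a b) (int (c mod (a + b)))"
      by (rule in_translate_modI) (metis of_nat_add of_nat_mod mod_add_eq le_add_diff_inverse2 that(2))
    then show False using \<Theta> mod_in_Zset_iff[OF ab, of x] that(1) unfolding Theta_ab_def by blast
  qed
  then show "x \<in> ?W \<longleftrightarrow> (\<forall>s\<in>{a, b, c}. 0 < s \<longrightarrow> s \<le> x \<longrightarrow> x - s \<notin> ?W)" for x
    using P_positions_iff[of x "{a, b}"] by auto
qed

text \<open>Every residue in [c, c + a) is \<open>c\<close> plus an element of the first block, so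
  on one period the candidate is just the two-move kernel cut off at \<open>c\<close>.\<close>

lemma P_positions_three_ca:
  fixes a b c :: nat
  assumes ab: "0 < a" "a < b" and bc: "b < c" and \<Theta>: "c mod (a + b) \<in> Theta_ca a b"
  shows "P_positions {a, b, c} = Tset a b c (c + a)"
proof -
  let ?W = "P_positions {a, b}"
  let ?K = "{r \<in> ?W. \<not> (c \<le> r \<and> r - c \<in> ?W)}"
  have W_iff: "x \<in> ?W \<longleftrightarrow> (a \<le> x \<longrightarrow> x - a \<notin> ?W) \<and> (b \<le> x \<longrightarrow> x - b \<notin> ?W)" for x
    using P_positions_iff[of x "{a, b}"] ab by simp
  have W_add: "x + a \<notin> ?W" if "x \<in> ?W" for x using W_iff[of "x + a"] that by simp
  have W_small: "x \<in> ?W" if "x < a" for x using W_iff[of x] that ab by simp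
  have K_iff: "r \<in> ?K \<longleftrightarrow> r < c \<and> r \<in> ?W" if "r < c + a" for r
    using that W_small[of "r - c"] by auto
  \<comment> \<open>Here r = (c + r - \<delta>) + (\<delta> - c), so a counterexample
    \<open>r\<close> lies in the triple intersection that \<open>Theta_ca\<close> makes
    empty.\<close>
  have b_wrap: "c + r - (b - a) \<notin> ?W" if "r \<in> ?W" "r < b - a" for r
  proof
    assume "c + r - (b - a) \<in> ?W"
    then have "(c + r - (b - a)) mod (a + b) \<in> Zset a b" using mod_in_Zset_iff[OF ab] by blast
    then have "r mod (a + b) \<in>
      translate_mod (a + b) (Zset a b) (int (b - a) - int (c mod (a + b)))"
    proof (rule in_translate_modI)
      have "int (c + r - (b - a)) + int (b - a) - int c = int r" using ab bc by linarith
      then show "(int ((c + r - (b - a)) mod (a + b)) + (int (b - a) - int (c mod (a + b))))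
          mod int (a + b) = int r mod int (a + b)"
        unfolding of_nat_mod mod_add_left_eq unfolding add_diff_eq mod_diff_right_eq by (rule arg_cong)
    qed
    moreover have "r mod (a + b) = r" using that(2) by simp
    moreover have "r \<in> Zset a b" using that unfolding Zset_def by simp
    ultimately show False using \<Theta> that(2) unfolding Theta_ca_def by auto
  qed
  have "P_positions {a, b, c} = {x. x mod (c + a) \<in> ?K}"
  proof (rule P_positions_periodicI)
    show "r - s \<notin> ?K" if r: "r < c + a" "r \<in> ?K" "s \<in> {a, b, c}" "s \<le> r" for r s
      using r K_iff[of r] W_iff[of r] by auto
    show "r + (c + a) - s \<notin> ?K" if r: "r < c + a" "r \<in> ?K" "s \<in> {a, b, c}" "r < s" for r s
    proof -
      have rW: "r \<in> ?W" and "r < c" using r K_iff by auto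
      consider "s = a" | "s = b" | "s = c" using r by blast
      then show ?thesis
      proof cases
        case 1
        then show ?thesis using K_iff[of "r + c"] r by simp
      next
        case 2
        have "r + (c + a) - s = c + r - (b - a)" using 2 ab bc by simp
        moreover have "c + r - (b - a) < c + a" using 2 r ab by linarith
        \<comment> \<open>A target at or above the cutoff \<open>c\<close> is outside
          \<open>?K\<close> anyway; \<open>b_wrap\<close> covers the rest.\<close>
        moreover have "c \<le> c + r - (b - a)" if "\<not> r < b - a" using that ab bc by linarith
        ultimately show ?thesis using K_iff[of "c + r - (b - a)"] b_wrap[OF rW]
          by (metis not_le)
      next
        case 3
        then show ?thesis using W_add[OF rW] by simp
      qed
    qed
    show "\<exists>s\<in>{a, b, c}. s \<le> r \<and> r - s \<in> ?K" if r: "r < c + a" "r \<notin> ?K" for r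
    proof (cases "c \<le> r")
      case True
      have "r - c < a" "r - c < c" using r(1) True ab bc by linarith+
      then have "r - c \<in> ?K" using W_small K_iff[of "r - c"] by auto
      then show ?thesis using True by blast
    next
      case False
      then have "r \<notin> ?W" using r K_iff by auto
      then obtain s where s: "s \<in> {a, b}" "s \<le> r" "r - s \<in> ?W" using W_iff[of r] by auto
      then have "r - s \<in> ?K" using False K_iff[of "r - s"] by auto
      then show ?thesis using s by blast
    qed
  qed (use ab bc in auto)
  then show ?thesis unfolding Tset_def by simp
qed

lemma P_positions_three_cb:
  fixes a b c :: nat
  assumes ab: "0 < a" "a < b" and bc: "b < c" and \<Theta>: "c mod (a + b) \<in> Theta_cb a b"
  shows "P_positions {a, b, c} = Tset a b c (c + b)"
proof -
  let ?W = "P_positions {a, b}"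
  let ?K = "{r \<in> ?W. \<not> (c \<le> r \<and> r - c \<in> ?W)}"
  have W_iff: "x \<in> ?W \<longleftrightarrow> (a \<le> x \<longrightarrow> x - a \<notin> ?W) \<and> (b \<le> x \<longrightarrow> x - b \<notin> ?W)" for x
    using P_positions_iff[of x "{a, b}"] ab by simp
  have W_add: "x + b \<notin> ?W" if "x \<in> ?W" for x using W_iff[of "x + b"] that by simp
  have W_small: "x \<in> ?W" if "x < a" for x using W_iff[of x] that ab by simp
  have transl: "(c + d) mod (a + b) \<in> translate_mod (a + b) X (int (c mod (a + b)))"
    if "d \<in> X" for d X
    using that by (rule in_translate_modI) (simp add: zmod_int mod_simps add.commute)
  \<comment> \<open>If \<open>y\<close> were in \<open>?W\<close>, then c + y would be outside
    \<open>?K\<close> by construction; so only \<open>y\<close> in \<open>Lam a b\<close>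
    matters.\<close>
  have a_wrap: "c + y \<notin> ?W" if "b - a \<le> y" "y < b" "y \<notin> ?W" for y
  proof -
    have "y \<in> Lam a b" using that unfolding Lam_eq[OF ab] by simp
    then show ?thesis
      using transl \<Theta> mod_in_Zset_iff[OF ab, of "c + y"] unfolding Theta_cb_def by blast
  qed
  \<comment> \<open>Moving by \<open>b\<close> is adding \<open>a\<close> modulo a + b. From a
    residue outside \<open>?W\<close> this can miss \<open>?W\<close> only if the residue lies in
    \<open>Lam a b\<close>, which the second condition excludes.\<close>
  have absorb_D: "c + d - b \<in> ?W" if d: "d < b" "d \<notin> ?W" "c + d \<notin> ?W" for d
  proof -
    have "d \<in> Dset a b"
      using d W_small[of d] unfolding Dset_def Zset_def by (auto simp: not_less[symmetric])
    then have notLam: "(c + d) mod (a + b) \<notin> Lam a b"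
      using transl \<Theta> unfolding Theta_cb_def by blast
    define y where "y = (c + d) mod (a + b)"
    have y: "y < a + b" using ab unfolding y_def by simp
    have yW: "y \<notin> ?W" using P_positions_two_mod[OF ab, of "c + d"] d(3) unfolding y_def by simp
    have cdb: "(c + d - b) mod (a + b) = (if b \<le> y then y - b else y + a)"
      using mod_diff_nat[of b "a + b" "c + d"] ab bc unfolding y_def by simp
    have "(c + d - b) mod (a + b) \<in> ?W"
    proof (cases "b \<le> y")
      case True
      then show ?thesis using W_small[of "y - b"] y cdb by simp
    next
      case False
      then have "y < b - a" using notLam yW unfolding Lam_eq[OF ab] y_def[symmetric] by auto
      \<comment> \<open>Below b - a the next block position still lies under \<open>b\<close>, so
        the parity change gives membership.\<close>
      then have "y + a < b" by linarith
      moreover have "odd (y div a)" using yW False P_positions_two_less[OF ab y] by simp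
      moreover have "(y + a) div a = Suc (y div a)" using ab by (simp add: div_add_self2)
      ultimately have "y + a \<in> ?W" using P_positions_two_less[OF ab, of "y + a"] by simp
      then show ?thesis using cdb False by simp
    qed
    then show ?thesis using P_positions_two_mod[OF ab] by blast
  qed
  have "P_positions {a, b, c} = {x. x mod (c + b) \<in> ?K}"
  proof (rule P_positions_periodicI)
    show "r - s \<notin> ?K" if r: "r < c + b" "r \<in> ?K" "s \<in> {a, b, c}" "s \<le> r" for r s
    proof -
      have "r \<in> ?W" "\<not> (c \<le> r \<and> r - c \<in> ?W)" using r(2) by blast+
      then have "r - s \<notin> ?W" using W_iff[of r] r(3,4) by blast
      then show ?thesis by blast
    qed
    show "r + (c + b) - s \<notin> ?K" if r: "r < c + b" "r \<in> ?K" "s \<in> {a, b, c}" "r < s" for r s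
    proof -
      have rW: "r \<in> ?W" using r by simp
      consider "s = a" | "s = b" | "s = c" using r by blast
      then show ?thesis
      proof cases
        case 1
        have "r + (c + b) - s = c + (r + (b - a))" using 1 ab by simp
        moreover have "r + (b - a) < b" using 1 r(4) ab by linarith
        ultimately show ?thesis using a_wrap[of "r + (b - a)"] by auto
      next
        case 2
        then show ?thesis using rW by simp
      next
        case 3
        then show ?thesis using W_add[OF rW] by simp
      qed
    qed
    show "\<exists>s\<in>{a, b, c}. s \<le> r \<and> r - s \<in> ?K" if r: "r < c + b" "r \<notin> ?K" for r
    proof (cases "r \<in> ?W")
      case True
      then have cr: "c \<le> r" "r - c \<in> ?W" using r(2) by blast+
      then have "r - c < c" using r(1) bc by linarith
      then have "r - c \<in> ?K" using cr(2) by simp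
      then show ?thesis using cr(1) by blast
    next
      case False
      show ?thesis
      proof (cases "c \<le> r")
        case True
        show ?thesis
        proof (cases "r - c \<in> ?W")
          case rc: True
          have "r - c < c" using r(1) True bc by linarith
          then have "r - c \<in> ?K" using rc by simp
          then show ?thesis using True by blast
        next
          case rc: False
          \<comment> \<open>Below \<open>c\<close> membership in \<open>?W\<close> already gives
            membership in \<open>?K\<close>.\<close>
          have "r - b < c" "b \<le> r" "r - c < b" "c + (r - c) = r" using r(1) True bc by linarith+
          then have "r - b \<in> ?K" using absorb_D[of "r - c"] rc False by simp
          then show ?thesis using \<open>b \<le> r\<close> by blast
        qed
      next
        case c: False
        obtain s where s: "s \<in> {a, b}" "s \<le> r" "r - s \<in> ?W" using W_iff[of r] False by auto
        then have "r - s \<in> ?K" using c by auto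
        then show ?thesis using s by blast
      qed
    qed
  qed (use ab bc in auto)
  then show ?thesis unfolding Tset_def by simp
qed

theorem theorem23:
  fixes a b c P :: nat
  assumes "2 \<le> a" and "a < b" and "b < c"
    and "c \<noteq> a + b"
    and "Gcd {a, b, c} = 1"
    and "P = a + b \<and> c mod (a + b) \<in> Theta_ab a b \<or>
         P = c + a \<and> c mod (a + b) \<in> Theta_ca a b \<or>
         P = c + b \<and> c mod (a + b) \<in> Theta_cb a b"
  shows "P_positions {a, b, c} =
           (if P = a + b then P_positions {a, b} else Tset a b c P) \<and>
         (\<forall>x. x \<in> P_positions {a, b, c} \<longleftrightarrow> x + P \<in> P_positions {a, b, c})"
proof -
  have ab: "0 < a" "a < b" using assms by auto
  have main: "P_positions {a, b, c} = (if P = a + b then P_positions {a, b} else Tset a b c P)"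
    using assms(6)
  proof (elim disjE conjE)
    assume "P = a + b" "c mod (a + b) \<in> Theta_ab a b"
    then show ?thesis using P_positions_three_ab[OF ab] by simp
  next
    assume "P = c + a" "c mod (a + b) \<in> Theta_ca a b"
    \<comment> \<open>From b < c the period differs from a + b, which selects the
      \<open>Tset\<close> branch.\<close>
    then show ?thesis using P_positions_three_ca[OF ab assms(3)] assms(3) by simp
  next
    assume "P = c + b" "c mod (a + b) \<in> Theta_cb a b"
    then show ?thesis using P_positions_three_cb[OF ab assms(3)] assms(2,3) by simp
  qed
  have "x \<in> P_positions {a, b} \<longleftrightarrow> x + (a + b) \<in> P_positions {a, b}" for x
    unfolding P_positions_two[OF ab] by simp
  moreover have "x \<in> Tset a b c P \<longleftrightarrow> x + P \<in> Tset a b c P" for x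
    unfolding Tset_def by simp
  ultimately show ?thesis unfolding main by simp
qed

end
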